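(* Let $q$ be a prime power and let $g\colon GF(q)^2\to GF(q)$ be any function. Let $l_\infty=\langle (0,0,0,1),(0,0,1,0)\rangle$ and consider the set of lines of $PG(3,q)$ $$\mathcal S_g = l_{\infty} \cup \{ \langle (0,1,x,y), (1,0,-y,g(x,y)) \rangle \ | \ x,y \in GF(q) \}.$$ Then $\mathcal S_g$ is a spread of $PG(3,q)$ (equivalently, a symplectic spread with respect to the alternating form $((x_0,x_1,x_2,x_3),(y_0,y_1,y_2,y_3))=x_0y_3-x_3y_0-x_1y_2+y_1x_2$) if and only if for all $a,b\in GF(q)$ the map $x \mapsto g(x,ax-b) + a^2x$ is a permutation of $GF(q)$.
   Context: $PG(3,q)$ is the projective space of dimension 3 over $GF(q)$, whose points are the nonzero vectors of $GF(q)^4$ modulo scalars; $\langle u,v\rangle$ denotes the line spanned by the points $u,v$. A spread of $PG(3,q)$ is a set of lines partitioning the points of $PG(3,q)$. A spread is symplectic if every line of it is totally isotropic with respect to a fixed non-degenerate alternating form, i.e. the form vanishes on any two points of the same line. All lines of $\mathcal S_g$ are totally isotropic with respect to the form given in the claim. *)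

theory Defs
  imports "HOL-Analysis.Analysis"
begin

text \<open>
  Points of the projective space of \<open>'a^'n\<close> are the classes of nonzero vectors modulo nonzero
  scalars. Lines are represented by their sets of points, so that a spread is literally a
  partition of the point set into lines. For \<open>'a :: {field, finite}\<close> with \<open>q\<close> elements,
  \<open>'a^4\<close> gives \<open>PG(3,q)\<close>.
\<close>

definition proportional :: "(('a::field^'n) \<times> ('a^'n)) set" where
  "proportional = {(u, v). u \<noteq> 0 \<and> v \<noteq> 0 \<and> (\<exists>c. c \<noteq> 0 \<and> v = c *s u)}"

definition pg_points :: "('a::field^'n) set set" where
  "pg_points = (UNIV - {0}) // proportional"

definition points_of :: "('a::field^'n) set \<Rightarrow> ('a^'n) set set" where
  "points_of W = (W - {0}) // proportional"

definition pg_lines :: "('a::field^'n) set set set" where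
  "pg_lines = {points_of W |W. vec.subspace W \<and> vec.dim W = 2}"

definition line_through :: "'a::field^'n \<Rightarrow> 'a^'n \<Rightarrow> ('a^'n) set set" where
  "line_through u v = points_of (vec.span {u, v})"

definition spread :: "('a::field^4) set set set \<Rightarrow> bool" where
  "spread S \<longleftrightarrow> S \<subseteq> pg_lines \<and> partition_on pg_points S"

definition alternating_form :: "('a::field^'n \<Rightarrow> 'a^'n \<Rightarrow> 'a) \<Rightarrow> bool" where
  "alternating_form B \<longleftrightarrow>
     (\<forall>u. Vector_Spaces.linear (*s) (*) (B u)) \<and>
     (\<forall>v. Vector_Spaces.linear (*s) (*) (\<lambda>u. B u v)) \<and>
     (\<forall>v. B v v = 0)"

definition nondegenerate :: "('a::field^'n \<Rightarrow> 'a^'n \<Rightarrow> 'a) \<Rightarrow> bool" where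
  "nondegenerate B \<longleftrightarrow> (\<forall>u. (\<forall>v. B u v = 0) \<longrightarrow> u = 0)"

definition totally_isotropic ::
    "('a::field^'n \<Rightarrow> 'a^'n \<Rightarrow> 'a) \<Rightarrow> ('a^'n) set set \<Rightarrow> bool" where
  "totally_isotropic B l \<longleftrightarrow> (\<forall>P\<in>l. \<forall>Q\<in>l. \<forall>u\<in>P. \<forall>v\<in>Q. B u v = 0)"

definition symplectic_spread ::
    "('a::field^4 \<Rightarrow> 'a^4 \<Rightarrow> 'a) \<Rightarrow> ('a^4) set set set \<Rightarrow> bool" where
  "symplectic_spread B S \<longleftrightarrow>
     alternating_form B \<and> nondegenerate B \<and> spread S \<and> (\<forall>l\<in>S. totally_isotropic B l)"

text \<open>
  Coordinates \<open>(x\<^sub>0, x\<^sub>1, x\<^sub>2, x\<^sub>3)\<close> are the components \<open>1, 2, 3, 4\<close> of \<open>'a^4\<close>, matching the order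
  of the entries in \<open>vector [x\<^sub>0, x\<^sub>1, x\<^sub>2, x\<^sub>3]\<close>:
\<close>

lemma vector_4_nth:
  "(vector [a, b, c, d] :: 'a::zero^4) $ 1 = a"
  "(vector [a, b, c, d] :: 'a::zero^4) $ 2 = b"
  "(vector [a, b, c, d] :: 'a::zero^4) $ 3 = c"
  "(vector [a, b, c, d] :: 'a::zero^4) $ 4 = d"
  by (simp_all add: vector_def)

text \<open>The form \<open>x\<^sub>0 y\<^sub>3 - x\<^sub>3 y\<^sub>0 - x\<^sub>1 y\<^sub>2 + y\<^sub>1 x\<^sub>2\<close>.\<close>

definition symp_form :: "'a::field^4 \<Rightarrow> 'a^4 \<Rightarrow> 'a" where
  "symp_form x y = x$1 * y$4 - x$4 * y$1 - x$2 * y$3 + y$2 * x$3"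

definition l_infinity :: "('a::field^4) set set" where
  "l_infinity = line_through (vector [0, 0, 0, 1]) (vector [0, 0, 1, 0])"

definition spread_set :: "('a::field \<times> 'a \<Rightarrow> 'a) \<Rightarrow> ('a^4) set set set" where
  "spread_set g = insert l_infinity
     {line_through (vector [0, 1, x, y]) (vector [1, 0, - y, g (x, y)]) |x y. True}"

end

theory Submission
  imports Defs
begin

text \<open>
  A vector \<open>(u\<^sub>0, u\<^sub>1, u\<^sub>2, u\<^sub>3)\<close> with \<open>(u\<^sub>0, u\<^sub>1) \<noteq> 0\<close> lies on the line with parameters
  \<open>(x, y)\<close> iff \<open>u\<^sub>2 = u\<^sub>1 x - u\<^sub>0 y\<close> and \<open>u\<^sub>3 = u\<^sub>1 y + u\<^sub>0 g(x, y)\<close>. For \<open>u\<^sub>0 = 0\<close> this determines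
  \<open>(x, y)\<close>. For \<open>u\<^sub>0 = 1\<close> put \<open>a = u\<^sub>1\<close> and \<open>b = u\<^sub>2\<close>: then \<open>y = a x - b\<close>, and \<open>x\<close> has to solve
  \<open>g(x, a x - b) + a\<^sup>2 x = u\<^sub>3 + a b\<close>.
  Since the field is finite, solvability of these equations already makes the maps bijective.
\<close>

section \<open>Points, lines and spreads via representative vectors\<close>

lemma equiv_proportional: "equiv (UNIV - {0}) (proportional :: (('a::field^'n) \<times> _) set)"
proof (rule equivI)
  show "proportional \<subseteq> (UNIV - {0}) \<times> (UNIV - {0 :: 'a^'n})"
    by (auto simp: proportional_def)
  show "refl_on (UNIV - {0 :: 'a^'n}) proportional"
    by (auto simp: refl_on_def proportional_def intro: exI[of _ 1])
  show "sym (proportional :: (('a^'n) \<times> _) set)"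
  proof (rule symI)
    fix u v :: "'a^'n" assume "(u, v) \<in> proportional"
    then obtain c where "u \<noteq> 0" "v \<noteq> 0" "c \<noteq> 0" "v = c *s u"
      by (auto simp: proportional_def)
    then show "(v, u) \<in> proportional"
      by (auto simp: proportional_def intro!: exI[of _ "inverse c"])
  qed
  show "trans (proportional :: (('a^'n) \<times> _) set)"
    by (rule transI) (auto simp: proportional_def)
qed

lemma mem_pg_points_iff: "P \<in> pg_points \<longleftrightarrow> (\<exists>u. u \<noteq> 0 \<and> P = proportional `` {u})"
  by (auto simp: pg_points_def quotient_def)

lemma points_of_subset: "points_of W \<subseteq> pg_points"
  by (auto simp: pg_points_def points_of_def quotient_def)

lemma mem_point_of_subspace:
  assumes W: "vec.subspace W" and P: "P \<in> points_of W" and v: "v \<in> P"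
  shows "v \<in> W"
proof -
  obtain u where u: "u \<in> W" "P = proportional `` {u}"
    using P by (auto simp: points_of_def quotient_def)
  then obtain c where "v = c *s u" using v by (auto simp: proportional_def)
  then show ?thesis using W u(1) by (simp add: vec.subspace_scale)
qed

text \<open>A subspace is closed under scaling, so it contains all representatives of a point as
  soon as it contains one. Incidence can thus be tested on a single vector.\<close>

lemma point_mem_points_of_iff:
  assumes "vec.subspace W" and "u \<noteq> 0"
  shows "proportional `` {u} \<in> points_of W \<longleftrightarrow> u \<in> W"
proof
  assume "proportional `` {u} \<in> points_of W"
  moreover have "u \<in> proportional `` {u}"
    using equiv_class_self[OF equiv_proportional] assms(2) by blast
  ultimately show "u \<in> W" using mem_point_of_subspace[OF assms(1)] by blast
next
  assume "u \<in> W"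
  then show "proportional `` {u} \<in> points_of W"
    using assms(2) by (auto simp: points_of_def intro: quotientI)
qed

lemma line_ne_empty:
  assumes "l \<in> pg_lines"
  shows "l \<noteq> {}"
proof -
  obtain W where l: "l = points_of W" and W: "vec.subspace W" "vec.dim W = 2"
    using assms by (auto simp: pg_lines_def)
  have "\<not> W \<subseteq> {0}" using W(2) by (metis vec.dim_eq_0 zero_neq_numeral)
  then obtain u where "u \<in> W" "u \<noteq> 0" by blast
  then show ?thesis using point_mem_points_of_iff[OF W(1)] l by blast
qed

text \<open>Turns the partition into unique incidence, which can be checked in coordinates one
  vector at a time. That blocks are nonempty and consist of points is automatic for lines.\<close>

lemma spread_iff:
  fixes S :: "('a::field^4) set set set"
  shows "spread S \<longleftrightarrow> S \<subseteq> pg_lines \<and> (\<forall>u. u \<noteq> 0 \<longrightarrow> (\<exists>!l. l \<in> S \<and> proportional `` {u} \<in> l))"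
proof (cases "S \<subseteq> pg_lines")
  case True
  then have sub: "\<Union>S \<subseteq> pg_points" using points_of_subset by (fastforce simp: pg_lines_def)
  have "{} \<notin> S" using True line_ne_empty by blast
  have "spread S \<longleftrightarrow> (\<forall>P\<in>pg_points. \<exists>!l. l \<in> S \<and> P \<in> l)"
  proof
    assume "spread S"
    then have "\<Union>S = pg_points" "disjoint S"
      by (auto simp: spread_def partition_on_def)
    then show "\<forall>P\<in>pg_points. \<exists>!l. l \<in> S \<and> P \<in> l"
      by (metis UnionE disjointD disjoint_iff)
  next
    assume *: "\<forall>P\<in>pg_points. \<exists>!l. l \<in> S \<and> P \<in> l"
    have "pg_points \<subseteq> \<Union>S"
    proof
      fix P :: "('a^4) set" assume "P \<in> pg_points"
      with * have "\<exists>!l. l \<in> S \<and> P \<in> l" by (rule bspec)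
      then show "P \<in> \<Union>S" by auto
    qed
    moreover have "disjoint S"
    proof (rule disjointI)
      fix l m assume lm: "l \<in> S" "m \<in> S" "l \<noteq> m"
      show "l \<inter> m = {}"
      proof (rule ccontr)
        assume "l \<inter> m \<noteq> {}"
        then obtain P where P: "P \<in> l" "P \<in> m" by blast
        then have "P \<in> pg_points" using sub lm by blast
        with * have "\<exists>!l. l \<in> S \<and> P \<in> l" by (rule bspec)
        with lm P show False by auto
      qed
    qed
    ultimately show "spread S"
      using True sub \<open>{} \<notin> S\<close> by (simp add: spread_def partition_on_def subset_antisym)
  qed
  moreover have "(\<forall>P\<in>pg_points. Q P) \<longleftrightarrow> (\<forall>u :: 'a^4. u \<noteq> 0 \<longrightarrow> Q (proportional `` {u}))" for Q
    unfolding Ball_def mem_pg_points_iff by metis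
  ultimately show ?thesis using True by simp
qed (simp add: spread_def)

section \<open>Equations of the lines of \<open>spread_set g\<close>\<close>

lemma mem_span_pair: "w \<in> vec.span {u, v} \<longleftrightarrow> (\<exists>s t. w = s *s u + t *s v)"
proof -
  have "w - s *s u = t *s v \<longleftrightarrow> w = s *s u + t *s v" for s t
    by (metis add.commute add_diff_cancel_right' diff_add_cancel)
  then show ?thesis
    by (auto simp: vec.span_insert vec.span_singleton)
qed

lemma line_through_mem_pg_lines:
  assumes "v \<noteq> 0" and "u \<notin> vec.span {v}"
  shows "line_through u v \<in> pg_lines"
proof -
  have "vec.independent {u, v}" and "u \<noteq> v"
    using assms by (auto simp: vec.independent_insert vec.span_base)
  then have "vec.dim (vec.span {u, v}) = 2"
    by (metis card_2_iff vec.dim_span_eq_card_independent)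
  then show ?thesis
    unfolding line_through_def pg_lines_def by blast
qed

lemma vec4_eq_iff:
  fixes u v :: "'a^4"
  shows "u = v \<longleftrightarrow> u$1 = v$1 \<and> u$2 = v$2 \<and> u$3 = v$3 \<and> u$4 = v$4"
  by (simp add: vec_eq_iff forall_4)

lemma mem_span_l_infinity:
  fixes u :: "'a::field^4"
  shows "u \<in> vec.span {vector [0, 0, 0, 1], vector [0, 0, 1, 0]} \<longleftrightarrow> u$1 = 0 \<and> u$2 = 0"
  by (simp add: mem_span_pair vec4_eq_iff vector_4_nth)

text \<open>The generators begin with \<open>0, 1\<close> and \<open>1, 0\<close>, so their
  coefficients must be \<open>u$2\<close> and \<open>u$1\<close>; the last two coordinates then give
  the equations.\<close>

lemma mem_span_line:
  fixes u :: "'a::field^4"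
  shows "u \<in> vec.span {vector [0, 1, x, y], vector [1, 0, - y, z]} \<longleftrightarrow>
    u$3 = u$2 * x - u$1 * y \<and> u$4 = u$2 * y + u$1 * z"
  by (simp add: mem_span_pair vec4_eq_iff vector_4_nth)

lemma spread_set_subset_pg_lines: "spread_set g \<subseteq> pg_lines"
proof -
  have "l_infinity \<in> (pg_lines :: ('a^4) set set set)"
    unfolding l_infinity_def
    by (rule line_through_mem_pg_lines)
       (auto simp: vec.span_singleton vec4_eq_iff vector_4_nth)
  moreover have "line_through (vector [0, 1, x, y]) (vector [1, 0, - y, z])
      \<in> (pg_lines :: ('a^4) set set set)" for x y z
    by (rule line_through_mem_pg_lines)
       (auto simp: vec.span_singleton vec4_eq_iff vector_4_nth)
  ultimately show ?thesis by (auto simp: spread_set_def)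
qed

lemma point_mem_l_infinity:
  fixes u :: "'a::field^4"
  assumes "u \<noteq> 0"
  shows "proportional `` {u} \<in> l_infinity \<longleftrightarrow> u$1 = 0 \<and> u$2 = 0"
  using assms
  by (simp add: l_infinity_def line_through_def point_mem_points_of_iff mem_span_l_infinity)

lemma point_mem_line:
  fixes u :: "'a::field^4"
  assumes "u \<noteq> 0"
  shows "proportional `` {u} \<in> line_through (vector [0, 1, x, y]) (vector [1, 0, - y, z]) \<longleftrightarrow>
    u$3 = u$2 * x - u$1 * y \<and> u$4 = u$2 * y + u$1 * z"
  using assms by (simp add: line_through_def point_mem_points_of_iff mem_span_line)

section \<open>Spreads and permutations\<close>

lemma bij_if_spread:
  fixes g :: "'a::{field, finite} \<times> 'a \<Rightarrow> 'a"
  assumes "spread (spread_set g)"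
  shows "bij (\<lambda>x. g (x, a * x - b) + a\<^sup>2 * x)"
proof -
  have "\<exists>x. d = g (x, a * x - b) + a\<^sup>2 * x" for d
  proof -
    \<comment> \<open>The last coordinate is shifted by \<open>a * b\<close> so that the equation
      for \<open>x\<close> has right-hand side exactly \<open>d\<close>. The first coordinate
      \<open>1\<close> keeps the point off \<open>l_infinity\<close>.\<close>
    let ?u = "vector [1, a, b, d - a * b] :: 'a^4"
    have u: "?u \<noteq> 0" by (auto simp: vec4_eq_iff vector_4_nth)
    then obtain l where "l \<in> spread_set g" "proportional `` {?u} \<in> l"
      using assms by (auto simp: spread_iff)
    then obtain x y where "b = a * x - y" "d - a * b = a * y + g (x, y)"
      by (auto simp: spread_set_def point_mem_l_infinity[OF u] point_mem_line[OF u] vector_4_nth)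
    then have y: "y = a * x - b" and "d = g (x, y) + (a * y + a * b)"
      by (simp_all add: algebra_simps)
    moreover have "a * y + a * b = a\<^sup>2 * x"
      unfolding y by (simp add: algebra_simps power2_eq_square)
    ultimately have "y = a * x - b" "d = g (x, y) + a\<^sup>2 * x" by simp_all
    then show ?thesis by auto
  qed
  then have "surj (\<lambda>x. g (x, a * x - b) + a\<^sup>2 * x)" by (simp add: surj_def)
  then show ?thesis by (simp add: bij_def finite_UNIV_surj_inj)
qed

text \<open>Surjectivity yields a line through each point with nonzero first coordinate and
  injectivity its uniqueness, so no counting of points enters.\<close>

lemma spread_if_bij:
  fixes g :: "'a::field \<times> 'a \<Rightarrow> 'a"
  assumes bij: "\<And>a b. bij (\<lambda>x. g (x, a * x - b) + a\<^sup>2 * x)"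
  shows "spread (spread_set g)"
  unfolding spread_iff
proof (intro conjI allI impI)
  show "spread_set g \<subseteq> pg_lines" by (rule spread_set_subset_pg_lines)
  let ?L = "\<lambda>x y. line_through (vector [0, 1, x, y]) (vector [1, 0, - y, g (x, y)])"
  have mem_spread_set: "l \<in> spread_set g \<longleftrightarrow> l = l_infinity \<or> (\<exists>x y. l = ?L x y)" for l
    by (auto simp: spread_set_def)
  fix u :: "'a^4" assume u: "u \<noteq> 0"
  note mem_l_infinity = point_mem_l_infinity[OF u] and mem_line = point_mem_line[OF u]
  show "\<exists>!l. l \<in> spread_set g \<and> proportional `` {u} \<in> l"
  proof (cases "u$1 = 0 \<and> u$2 = 0")
    case True
    then have "\<not> (u$3 = 0 \<and> u$4 = 0)" using u by (auto simp: vec4_eq_iff)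
    \<comment> \<open>With \<open>u$1 = u$2 = 0\<close> the equations of \<open>?L x y\<close> would
      force \<open>u$3 = u$4 = 0\<close>.\<close>
    then have "proportional `` {u} \<notin> ?L x y" for x y
      using True by (simp add: mem_line)
    moreover have "proportional `` {u} \<in> l_infinity"
      using True by (simp add: mem_l_infinity)
    ultimately show ?thesis unfolding mem_spread_set by metis
  next
    case False
    \<comment> \<open>Uniqueness is shown for the parameters, which implies it for the line.\<close>
    have "\<exists>x0 y0. \<forall>x y. u$3 = u$2 * x - u$1 * y \<and> u$4 = u$2 * y + u$1 * g (x, y) \<longleftrightarrow>
        x = x0 \<and> y = y0"
    proof (cases "u$1 = 0")
      case True
      then have "u$3 = u$2 * x - u$1 * y \<and> u$4 = u$2 * y + u$1 * g (x, y) \<longleftrightarrow>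
          x = u$3 / u$2 \<and> y = u$4 / u$2" for x y
        using False by (auto simp: field_simps)
      then show ?thesis by blast
    next
      case u1: False
      \<comment> \<open>The equations are homogeneous in \<open>u\<close>; dividing by
        \<open>u$1\<close> normalises the representative to \<open>(1, a, b, d)\<close>.\<close>
      define a b d where "a = u$2 / u$1" and "b = u$3 / u$1" and "d = u$4 / u$1"
      have sol: "u$3 = u$2 * x - u$1 * y \<and> u$4 = u$2 * y + u$1 * g (x, y) \<longleftrightarrow>
          y = a * x - b \<and> g (x, a * x - b) + a\<^sup>2 * x = d + a * b" for x y
      proof -
        have "u$3 = u$2 * x - u$1 * y \<longleftrightarrow> y = a * x - b"
          using u1 by (auto simp: a_def b_def field_simps)
        moreover have "u$4 = u$2 * y + u$1 * g (x, y) \<longleftrightarrow> d = a * y + g (x, y)"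
          using u1 by (auto simp: a_def d_def field_simps)
        moreover have "d = a * (a * x - b) + z \<longleftrightarrow> z + a\<^sup>2 * x = d + a * b" for z
          by (auto simp: algebra_simps power2_eq_square)
        ultimately show ?thesis by auto
      qed
      \<comment> \<open>The unique preimage of \<open>d + a * b\<close> serves as \<open>x0\<close>,
        and \<open>a * x - b\<close> as \<open>y0\<close>.\<close>
      obtain x where "\<And>x'. g (x', a * x' - b) + a\<^sup>2 * x' = d + a * b \<longleftrightarrow> x' = x"
        using bij_pointE[OF bij[of a b]] by metis
      then show ?thesis unfolding sol by metis
    qed
    then obtain x0 y0 where "\<And>x y. proportional `` {u} \<in> ?L x y \<longleftrightarrow> x = x0 \<and> y = y0"
      unfolding mem_line by blast
    moreover have "proportional `` {u} \<notin> l_infinity"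
      using False by (simp add: mem_l_infinity)
    ultimately show ?thesis unfolding mem_spread_set by metis
  qed
qed

section \<open>The alternating form and total isotropy\<close>

lemma vector_space_field: "vector_space ((*) :: 'a::field \<Rightarrow> 'a \<Rightarrow> 'a)"
  by unfold_locales (simp_all add: algebra_simps)

lemma alternating_form_symp_form: "alternating_form (symp_form :: 'a::field^4 \<Rightarrow> _)"
  unfolding alternating_form_def Vector_Spaces.linear_iff
  \<comment> \<open>\<open>linear_iff\<close> also asks that source and target be vector spaces; the
    target is the field over itself.\<close>
  by (simp add: vec.vector_space_axioms vector_space_field)
     (simp add: symp_form_def algebra_simps)

lemma nondegenerate_symp_form: "nondegenerate (symp_form :: 'a::field^4 \<Rightarrow> _)"
  unfolding nondegenerate_def
proof (intro allI impI)
  fix u :: "'a^4" assume *: "\<forall>v. symp_form u v = 0"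
  show "u = 0"
    \<comment> \<open>Pairing with the four unit vectors returns \<open>- u$4\<close>,
      \<open>u$3\<close>, \<open>- u$2\<close> and \<open>u$1\<close>.\<close>
    using *[rule_format, of "vector [1, 0, 0, 0]"] *[rule_format, of "vector [0, 1, 0, 0]"]
      *[rule_format, of "vector [0, 0, 1, 0]"] *[rule_format, of "vector [0, 0, 0, 1]"]
    by (simp add: symp_form_def vector_4_nth vec4_eq_iff)
qed

lemma totally_isotropic_line_through:
  assumes "\<And>u v. u \<in> vec.span {w, z} \<Longrightarrow> v \<in> vec.span {w, z} \<Longrightarrow> B u v = 0"
  shows "totally_isotropic B (line_through w z)"
  unfolding totally_isotropic_def line_through_def
  using assms mem_point_of_subspace[OF vec.subspace_span] by blast

text \<open>Isotropy holds for every \<open>g\<close>, because the fourth coordinate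
  \<open>z\<close> of the second generator cancels in the form. Hence being a spread and being a
  symplectic one coincide here.\<close>

lemma totally_isotropic_spread_set:
  fixes g :: "'a::field \<times> 'a \<Rightarrow> 'a"
  assumes "l \<in> spread_set g"
  shows "totally_isotropic symp_form l"
proof -
  have "totally_isotropic symp_form (l_infinity :: ('a^4) set set)"
    unfolding l_infinity_def
    by (rule totally_isotropic_line_through) (simp add: mem_span_l_infinity symp_form_def)
  moreover have "totally_isotropic symp_form
      (line_through (vector [0, 1, x, y]) (vector [1, 0, - y, z]) :: ('a^4) set set)" for x y z
  proof (rule totally_isotropic_line_through)
    fix u v :: "'a^4"
    assume "u \<in> vec.span {vector [0, 1, x, y], vector [1, 0, - y, z]}"
      and "v \<in> vec.span {vector [0, 1, x, y], vector [1, 0, - y, z]}"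
    then have "u$3 = u$2 * x - u$1 * y" "u$4 = u$2 * y + u$1 * z"
      and "v$3 = v$2 * x - v$1 * y" "v$4 = v$2 * y + v$1 * z"
      by (simp_all add: mem_span_line)
    then show "symp_form u v = 0"
      \<comment> \<open>The first call only substitutes the third and fourth coordinates; then the
        terms in \<open>x\<close>, \<open>y\<close> and \<open>z\<close> cancel separately.\<close>
      unfolding symp_form_def by (simp only:) (simp add: algebra_simps)
  qed
  ultimately show ?thesis using assms by (auto simp: spread_set_def)
qed

theorem theorem1:
  fixes g :: "'a::{field, finite} \<times> 'a \<Rightarrow> 'a"
  shows "(spread (spread_set g) \<longleftrightarrow>
            (\<forall>a b. bij (\<lambda>x. g (x, a * x - b) + a\<^sup>2 * x)))
       \<and> (symplectic_spread symp_form (spread_set g) \<longleftrightarrow> spread (spread_set g))"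
proof
  show "spread (spread_set g) \<longleftrightarrow> (\<forall>a b. bij (\<lambda>x. g (x, a * x - b) + a\<^sup>2 * x))"
    using bij_if_spread spread_if_bij by blast
  show "symplectic_spread symp_form (spread_set g) \<longleftrightarrow> spread (spread_set g)"
    by (auto simp: symplectic_spread_def alternating_form_symp_form nondegenerate_symp_form
        totally_isotropic_spread_set)
qed

end
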